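(* The coefficient functions satisfy the identities $$\frac{\phi_{n+1}(0)}{\phi_n(0)}\Theta_n(z)-\frac{\kappa_n}{\kappa_{n-1}}z\Theta_{n-1}(z)=\frac{\bar\phi_{n+1}(0)}{\bar\phi_n(0)}z\Theta^*_n(z)-\frac{\kappa_n}{\kappa_{n-1}}\Theta^*_{n-1}(z)\qquad(n\ge1),$$ $$\Omega^*_n(z)-\Omega_n(z)=-\frac{\kappa_{n+1}}{\kappa_n}(z\Theta_n(z)-\Theta^*_n(z))+n\frac{W(z)}{z}\qquad(n\ge0),$$ $$\Omega^*_n(z)+\Omega_n(z)=\frac{\kappa_n^2}{\kappa_{n+1}^2}\left[\frac{\phi_{n+2}(0)}{\phi_{n+1}(0)}\Theta_{n+1}(z)+\frac{\kappa_{n+1}}{\kappa_n}\Theta^*_n(z)\right]+\frac{W(z)}{z}\qquad(n\ge0).$$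
   Context: Let $\mathbb T=\{\zeta\in\mathbb C:|\zeta|=1\}$, $\zeta=e^{i\theta}$, $\theta\in(-\pi,\pi]$. The weight $w$ is a complex (not necessarily real or positive) function, analytic in a cut complex plane, with $z^jw,z^jw'\in L^1(\mathbb T)$ for all $j\in\mathbb Z$ and with expansion $w(z)=\sum_{k\in\mathbb Z}w_kz^k$, $w_k=\int_{\mathbb T}\frac{d\zeta}{2\pi i\zeta}w(\zeta)\zeta^{-k}$, converging in an annulus containing $\mathbb T$. Assume $\det[w_{j-k}]_{0\le j,k\le n-1}\ne0$ for all $n\ge1$. The bi-orthonormal polynomials are $\phi_n(z)=\kappa_nz^n+\dots+\phi_n(0)$ and $\bar\phi_n(z)=\kappa_nz^n+\dots+\bar\phi_n(0)$, of degree $n$ with the same leading coefficient $\kappa_n\ne0$, satisfying $\int_{\mathbb T}\frac{d\zeta}{2\pi i\zeta}w(\zeta)\phi_m(\zeta)\bar\phi_n(\bar\zeta)=\delta_{m,n}$ with $\bar\zeta=\zeta^{-1}$ on $\mathbb T$; the bar on $\bar\phi_n$ is notation and does not denote complex conjugation. The reciprocal polynomial is $\phi^*_n(z)=z^n\bar\phi_n(1/z)$. It is assumed that $\phi_n(0)\neq0$ and $\bar\phi_n(0)\ne0$ for all $n$. With $F(z)=\int_{\mathbb T}\frac{d\zeta}{2\pi i\zeta}\frac{\zeta+z}{\zeta-z}w(\zeta)$, the associated functions, defined for $z\notin\mathbb T$, are $\epsilon_n(z)=\int_{\mathbb T}\frac{d\zeta}{2\pi i\zeta}\frac{\zeta+z}{\zeta-z}w(\zeta)\phi_n(\zeta)$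 and $\epsilon^*_n(z)=-z^n\int_{\mathbb T}\frac{d\zeta}{2\pi i\zeta}\frac{\zeta+z}{\zeta-z}w(\zeta)\bar\phi_n(\bar\zeta)$ for $n\ge1$, and $\epsilon_0=1/\kappa_0+\kappa_0F$, $\epsilon^*_0=1/\kappa_0-\kappa_0F$. $W(z)\not\equiv0$ and $V(z)$ are functions independent of $n$ with $Ww'=2Vw$, and the coefficient functions $\Theta_n,\Omega_n,\Theta^*_n,\Omega^*_n$ ($n\ge0$) are the functions determined by the relations $W\phi'_n=\Theta_n\phi_{n+1}-(\Omega_n+V)\phi_n$, $W\epsilon'_n=\Theta_n\epsilon_{n+1}-(\Omega_n-V)\epsilon_n$, $W\phi^{*\prime}_n=-\Theta^*_n\phi^*_{n+1}+(\Omega^*_n-V)\phi^*_n$, $W\epsilon^{*\prime}_n=-\Theta^*_n\epsilon^*_{n+1}+(\Omega^*_n+V)\epsilon^*_n$ (here $'=d/dz$). *)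

theory Defs
  imports
    "HOL-Complex_Analysis.Complex_Analysis"
    "Jordan_Normal_Form.Determinant"
begin

text \<open>The normalised integral of \<open>f(\<zeta>) d\<zeta> / (2 \<pi> i \<zeta>)\<close> over the unit circle.\<close>

definition circle_int :: "(complex \<Rightarrow> complex) \<Rightarrow> complex" where
  "circle_int f =
     contour_integral (circlepath 0 1) (\<lambda>\<zeta>. f \<zeta> / (2 * of_real pi * \<i> * \<zeta>))"

definition L1_circle :: "(complex \<Rightarrow> complex) \<Rightarrow> bool" where
  "L1_circle f \<longleftrightarrow> (\<lambda>\<theta>. f (cis \<theta>)) absolutely_integrable_on {-pi<..pi}"

definition fourier_coeff :: "(complex \<Rightarrow> complex) \<Rightarrow> int \<Rightarrow> complex" where
  "fourier_coeff w k = circle_int (\<lambda>\<zeta>. w \<zeta> * \<zeta> powi (- k))"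

definition toeplitz_det :: "(complex \<Rightarrow> complex) \<Rightarrow> nat \<Rightarrow> complex" where
  "toeplitz_det w n =
     Determinant.det (Matrix.mat n n (\<lambda>(j, k). fourier_coeff w (int j - int k)))"

text \<open>
  In the next definition \<open>p'\<close> is an independent polynomial: neither its coefficients nor
  its values are obtained from \<open>p\<close> by complex conjugation.  It is evaluated at
  \<open>1/\<zeta>\<close>, which is the conjugate of \<open>\<zeta>\<close> on the unit circle.
\<close>

definition circle_pairing ::
    "(complex \<Rightarrow> complex) \<Rightarrow> complex poly \<Rightarrow> complex poly \<Rightarrow> complex" where
  "circle_pairing w p p' = circle_int (\<lambda>\<zeta>. w \<zeta> * poly p \<zeta> * poly p' (1 / \<zeta>))"

definition biorthonormal ::
    "(complex \<Rightarrow> complex) \<Rightarrow> (nat \<Rightarrow> complex) \<Rightarrow> (nat \<Rightarrow> complex poly) \<Rightarrow> (nat \<Rightarrow> complex poly) \<Rightarrow> bool"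
  where
  "biorthonormal w \<kappa> \<phi> \<phi>b \<longleftrightarrow>
     (\<forall>n. \<kappa> n \<noteq> 0) \<and>
     (\<forall>n. degree (\<phi> n) = n \<and> lead_coeff (\<phi> n) = \<kappa> n) \<and>
     (\<forall>n. degree (\<phi>b n) = n \<and> lead_coeff (\<phi>b n) = \<kappa> n) \<and>
     (\<forall>m n. circle_pairing w (\<phi> m) (\<phi>b n) = (if m = n then 1 else 0))"

text \<open>
  The reciprocal polynomial is \<^const>\<open>reflect_poly\<close> of the second family; as the degree of
  the \<open>n\<close>-th member is \<open>n\<close>, it takes the value \<open>z^n * p(1/z)\<close> at \<open>z\<close>:
\<close>

lemma poly_reflect_poly_degree:
  fixes p :: "complex poly"
  assumes "degree p = n" "z \<noteq> 0"
  shows "poly (reflect_poly p) z = z ^ n * poly p (1 / z)"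
  using assms by (simp add: poly_reflect_poly_nz inverse_eq_divide)

definition caratheodory :: "(complex \<Rightarrow> complex) \<Rightarrow> complex \<Rightarrow> complex" where
  "caratheodory w z = circle_int (\<lambda>\<zeta>. (\<zeta> + z) / (\<zeta> - z) * w \<zeta>)"

text \<open>The associated functions; they are only meaningful for \<open>z\<close> off the unit circle.\<close>

definition assoc_fun ::
    "(complex \<Rightarrow> complex) \<Rightarrow> (nat \<Rightarrow> complex) \<Rightarrow> (nat \<Rightarrow> complex poly) \<Rightarrow> nat \<Rightarrow> complex \<Rightarrow> complex"
  where
  "assoc_fun w \<kappa> \<phi> n z =
     (if n = 0 then 1 / \<kappa> 0 + \<kappa> 0 * caratheodory w z
      else circle_int (\<lambda>\<zeta>. (\<zeta> + z) / (\<zeta> - z) * w \<zeta> * poly (\<phi> n) \<zeta>))"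

definition assoc_fun_star ::
    "(complex \<Rightarrow> complex) \<Rightarrow> (nat \<Rightarrow> complex) \<Rightarrow> (nat \<Rightarrow> complex poly) \<Rightarrow> nat \<Rightarrow> complex \<Rightarrow> complex"
  where
  "assoc_fun_star w \<kappa> \<phi>b n z =
     (if n = 0 then 1 / \<kappa> 0 - \<kappa> 0 * caratheodory w z
      else - (z ^ n) * circle_int (\<lambda>\<zeta>. (\<zeta> + z) / (\<zeta> - z) * w \<zeta> * poly (\<phi>b n) (1 / \<zeta>)))"

text \<open>
  The four relations which determine the coefficient functions at a point \<open>z\<close>.  For fixed
  \<open>z\<close> off the unit circle and \<open>z \<noteq> 0\<close>, the first two and the last two are non-degenerate
  2-by-2 linear systems for the values of \<open>\<Theta> n, \<Omega> n\<close> and of \<open>\<Theta>s n, \<Omega>s n\<close> at \<open>z\<close>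
  (the determinants are nonzero multiples of \<open>z ^ n\<close> and \<open>z ^ (n + 1)\<close>).
\<close>

definition coefficient_relations ::
    "(complex \<Rightarrow> complex) \<Rightarrow> (nat \<Rightarrow> complex) \<Rightarrow> (nat \<Rightarrow> complex poly) \<Rightarrow> (nat \<Rightarrow> complex poly) \<Rightarrow>
     (complex \<Rightarrow> complex) \<Rightarrow> (complex \<Rightarrow> complex) \<Rightarrow>
     (nat \<Rightarrow> complex \<Rightarrow> complex) \<Rightarrow> (nat \<Rightarrow> complex \<Rightarrow> complex) \<Rightarrow>
     (nat \<Rightarrow> complex \<Rightarrow> complex) \<Rightarrow> (nat \<Rightarrow> complex \<Rightarrow> complex) \<Rightarrow>
     nat \<Rightarrow> complex \<Rightarrow> bool"
  where
  "coefficient_relations w \<kappa> \<phi> \<phi>b W V \<Theta> \<Omega> \<Theta>s \<Omega>s n z \<longleftrightarrow>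
     (let p = (\<lambda>n. poly (\<phi> n));
          e = assoc_fun w \<kappa> \<phi>;
          ps = (\<lambda>n. poly (reflect_poly (\<phi>b n)));
          es = assoc_fun_star w \<kappa> \<phi>b
      in W z * deriv (p n) z = \<Theta> n z * p (n + 1) z - (\<Omega> n z + V z) * p n z \<and>
         W z * deriv (e n) z = \<Theta> n z * e (n + 1) z - (\<Omega> n z - V z) * e n z \<and>
         W z * deriv (ps n) z = - \<Theta>s n z * ps (n + 1) z + (\<Omega>s n z - V z) * ps n z \<and>
         W z * deriv (es n) z = - \<Theta>s n z * es (n + 1) z + (\<Omega>s n z + V z) * es n z)"

end

theory Submission
  imports Defs
begin

text \<open>
  The identities express that two descriptions of the same objects are compatible: a recurrence
  in \<open>n\<close> and a differential equation in \<open>z\<close>.  Put the polynomials and their associated functions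
  into the vectors \<open>p\<^sub>n = (\<phi>\<^sub>n, \<epsilon>\<^sub>n)\<close> and \<open>s\<^sub>n = (\<phi>*\<^sub>n, -\<epsilon>*\<^sub>n)\<close>.  With
  \<open>a = \<phi>\<^sub>n\<^sub>+\<^sub>1(0)\<close> and \<open>b\<close> the value at \<open>0\<close> of the \<open>n+1\<close>-st polynomial of the second family, both
  components obey the same Szego recurrences
  \<open>\<kappa>\<^sub>n p\<^sub>n\<^sub>+\<^sub>1 = \<kappa>\<^sub>n\<^sub>+\<^sub>1 z p\<^sub>n + a s\<^sub>n\<close> and \<open>\<kappa>\<^sub>n s\<^sub>n\<^sub>+\<^sub>1 = b z p\<^sub>n + \<kappa>\<^sub>n\<^sub>+\<^sub>1 s\<^sub>n\<close>,
  where \<open>\<kappa>\<^sub>n\<^sub>+\<^sub>1\<^sup>2 - \<kappa>\<^sub>n\<^sup>2 = a b\<close>.  Hence \<open>det(p\<^sub>n, s\<^sub>n)\<close> is multiplied by \<open>z\<close> when \<open>n\<close> increases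
  by one, so it equals \<open>-2 z^n\<close> (\<open>casoratian\<close>), and \<open>p\<^sub>n\<close>, \<open>s\<^sub>n\<close> form a basis when \<open>z \<noteq> 0\<close>.

  Let \<open>\<D> = W d/dz + diag(V, -V)\<close>.  The relations which determine the coefficient functions say
  \<open>\<D> p\<^sub>n = \<Theta>\<^sub>n p\<^sub>n\<^sub>+\<^sub>1 - \<Omega>\<^sub>n p\<^sub>n\<close> and \<open>\<D> s\<^sub>n = -\<Theta>*\<^sub>n s\<^sub>n\<^sub>+\<^sub>1 + \<Omega>*\<^sub>n s\<^sub>n\<close>.  As \<open>diag(V, -V)\<close> has
  trace zero, differentiating the determinant gives \<open>\<Omega>*\<^sub>n - \<Omega>\<^sub>n\<close> (\<open>omega_diff\<close>).  Applying \<open>\<D>\<close> to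
  the first recurrence and comparing coefficients of \<open>p\<^sub>n\<close> in the basis \<open>p\<^sub>n\<close>, \<open>p\<^sub>n\<^sub>+\<^sub>1\<close> gives one
  formula for \<open>\<Omega>*\<^sub>n + \<Omega>\<^sub>n\<close> (\<open>omega_sum_phi\<close>); the second recurrence, in the basis
  \<open>s\<^sub>n\<close>, \<open>s\<^sub>n\<^sub>+\<^sub>1\<close>, gives another (\<open>omega_sum_reciprocal\<close>).  Equating the two is the identity between
  \<open>\<Theta>\<close> and \<open>\<Theta>*\<close> alone (\<open>theta_relation\<close>).

  The recurrences come from bi-orthogonality.  For the polynomials, the difference of the two
  sides is orthogonal to so many monomials that it vanishes (\<open>zero_if_orthogonal_shifted\<close>).  For
  the associated functions, the recurrences are transported through the linear map
  \<open>p \<mapsto> \<integral> (\<zeta> + z)/(\<zeta> - z) w(\<zeta>) p(\<zeta>) d\<zeta>/(2\<pi>i\<zeta>)\<close>: up to constants, \<open>\<epsilon>\<^sub>n\<close> and \<open>-\<epsilon>*\<^sub>n\<close> are the images of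
  \<open>\<phi>\<^sub>n\<close> and \<open>\<phi>*\<^sub>n\<close>, and the constants cancel by orthogonality.
\<close>

hide_const (open) Module.module.smult

section \<open>Integration over the unit circle\<close>

lemma circle_int_integrable:
  assumes "continuous_on (sphere 0 1) f"
  shows "(\<lambda>\<zeta>. f \<zeta> / (2 * of_real pi * \<i> * \<zeta>)) contour_integrable_on circlepath 0 1"
  by (rule contour_integrable_continuous_circlepath) (auto intro!: continuous_intros assms)

lemma circle_int_cong:
  assumes "\<And>\<zeta>. cmod \<zeta> = 1 \<Longrightarrow> f \<zeta> = g \<zeta>"
  shows "circle_int f = circle_int g"
  unfolding circle_int_def by (rule contour_integral_eq) (auto simp: assms)

lemma circle_int_add:
  assumes "continuous_on (sphere 0 1) f" "continuous_on (sphere 0 1) g"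
  shows "circle_int (\<lambda>\<zeta>. f \<zeta> + g \<zeta>) = circle_int f + circle_int g"
  using contour_integral_add[OF circle_int_integrable[OF assms(1)] circle_int_integrable[OF assms(2)]]
  by (simp add: circle_int_def add_divide_distrib)

lemma circle_int_cmult:
  assumes "continuous_on (sphere 0 1) f"
  shows "circle_int (\<lambda>\<zeta>. c * f \<zeta>) = c * circle_int f"
  using contour_integral_lmul[OF circle_int_integrable[OF assms], of c]
  by (simp add: circle_int_def)

text \<open>
  Convergence at the single point \<open>1\<close> makes the coefficients absolutely summable, and their
  moduli dominate the terms on the whole circle, so the M-test applies.
\<close>

lemma continuous_on_circle_Laurent:
  fixes c :: "int \<Rightarrow> complex"
  assumes "\<And>z. cmod z = 1 \<Longrightarrow> ((\<lambda>k. c k * z powi k) has_sum w z) UNIV"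
  shows "continuous_on (sphere 0 1) w"
proof -
  have "c summable_on UNIV"
    using assms[of 1] by (auto simp: summable_on_def)
  then have summable: "(\<lambda>k. cmod (c k)) summable_on UNIV"
    by (simp add: summable_on_iff_abs_summable_on_complex)
  have "uniform_limit (sphere 0 1) (\<lambda>K z. \<Sum>k\<in>K. c k * z powi k)
          (\<lambda>z. \<Sum>\<^sub>\<infinity>k. c k * z powi k) (finite_subsets_at_top UNIV)"
    by (rule Weierstrass_m_test_general[OF _ summable]) (auto simp: norm_mult norm_power_int)
  then have "continuous_on (sphere 0 1) (\<lambda>z. \<Sum>\<^sub>\<infinity>k. c k * z powi k)"
    by (rule uniform_limit_theorem[rotated])
       (auto intro!: always_eventually continuous_intros)
  moreover have "(\<Sum>\<^sub>\<infinity>k. c k * z powi k) = w z" if "z \<in> sphere 0 1" for z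
    using that assms[of z] by (auto intro: infsumI)
  ultimately show ?thesis
    by (metis (no_types, lifting) continuous_on_cong)
qed

lemma field_differentiable_cong_open:
  assumes "f field_differentiable at z" "open S" "z \<in> S" "\<And>x. x \<in> S \<Longrightarrow> f x = g x"
  shows "g field_differentiable at z"
  using assms has_field_derivative_transform_within_open
  unfolding field_differentiable_def by blast

lemma poly_differentiable: "poly p field_differentiable at x" for x :: complex
  unfolding field_differentiable_def by (rule exI) (rule poly_DERIV)

section \<open>Linear functionals on polynomials\<close>

lemma cancel_top_coeff:
  fixes p q :: "complex poly"
  assumes q: "degree q = n" "q \<noteq> 0" and p: "\<And>k. k > n \<Longrightarrow> coeff p k = 0" and "k \<ge> n"
  shows "coeff (p - smult (coeff p n / lead_coeff q) q) k = 0"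
proof (cases "k = n")
  case True
  then show ?thesis using q leading_coeff_neq_0[of q] by simp
next
  case False
  then show ?thesis using \<open>k \<ge> n\<close> p[of k] q by (simp add: coeff_eq_0)
qed

text \<open>
  A sequence with one polynomial of each degree is triangular with respect to the monomials.
  The condition on \<open>p\<close> is a bound on its degree by \<open>n - 1\<close> which for \<open>n = 0\<close> forces \<open>p = 0\<close>.
\<close>

lemma linear_functional_vanishes:
  fixes f :: "complex poly \<Rightarrow> complex"
  assumes add: "\<And>p q. f (p + q) = f p + f q"
    and smult: "\<And>c p. f (smult c p) = c * f p"
    and deg: "\<And>k. degree (\<psi> k) = k" "\<And>k. \<psi> k \<noteq> 0"
    and zero: "\<And>k. k < n \<Longrightarrow> f (\<psi> k) = 0"
    and p: "\<And>k. k \<ge> n \<Longrightarrow> coeff p k = 0"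
  shows "f p = 0"
  using zero p
proof (induction n arbitrary: p)
  case 0
  then have "p = smult 0 p" by (simp add: poly_eq_iff)
  then show ?case using smult[of 0 p] by simp
next
  case (Suc n)
  define c where "c = coeff p n / lead_coeff (\<psi> n)"
  define q where "q = p - smult c (\<psi> n)"
  have "coeff q k = 0" if "k \<ge> n" for k
    unfolding q_def c_def using Suc.prems(2) that by (intro cancel_top_coeff deg) auto
  then have "f q = 0" using Suc by simp
  moreover have "p = q + smult c (\<psi> n)" by (simp add: q_def)
  ultimately show ?case using add[of q "smult c (\<psi> n)"] smult Suc.prems(1)[of n] by simp
qed

text \<open>
  Bi-orthogonality is used in this form only: on polynomials of degree at most \<open>n\<close>, pairing
  with the \<open>n\<close>-th member of either family reads off the coefficient of degree \<open>n\<close>.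
\<close>

lemma linear_functional_top_coeff:
  fixes f :: "complex poly \<Rightarrow> complex"
  assumes add: "\<And>p q. f (p + q) = f p + f q"
    and smult: "\<And>c p. f (smult c p) = c * f p"
    and deg: "\<And>k. degree (\<psi> k) = k" "\<And>k. \<psi> k \<noteq> 0"
    and zero: "\<And>k. k < n \<Longrightarrow> f (\<psi> k) = 0"
    and p: "degree p \<le> n"
  shows "f p = coeff p n / lead_coeff (\<psi> n) * f (\<psi> n)"
proof -
  define c where "c = coeff p n / lead_coeff (\<psi> n)"
  define q where "q = p - smult c (\<psi> n)"
  have "coeff q k = 0" if "k \<ge> n" for k
    unfolding q_def c_def using p that by (intro cancel_top_coeff deg) (auto simp: coeff_eq_0)
  then have "f q = 0" using linear_functional_vanishes[OF add smult deg zero, of n q] by simp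
  moreover have "p = q + smult c (\<psi> n)" by (simp add: q_def)
  ultimately show ?thesis using add[of q "smult c (\<psi> n)"] smult by (simp add: c_def)
qed

section \<open>Bi-orthonormal polynomials\<close>

locale biorthonormal_system =
  fixes w :: "complex \<Rightarrow> complex" and \<kappa> :: "nat \<Rightarrow> complex" and \<phi> \<phi>b :: "nat \<Rightarrow> complex poly"
  assumes w_cont: "continuous_on (sphere 0 1) w"
    and biorth: "biorthonormal w \<kappa> \<phi> \<phi>b"
begin

abbreviation pairing :: "complex poly \<Rightarrow> complex poly \<Rightarrow> complex" where
  "pairing \<equiv> circle_pairing w"

abbreviation \<phi>s :: "nat \<Rightarrow> complex poly" where
  "\<phi>s n \<equiv> reflect_poly (\<phi>b n)"

lemma kappa_nz: "\<kappa> n \<noteq> 0"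
  and degree_phi: "degree (\<phi> n) = n"
  and coeff_phi: "coeff (\<phi> n) n = \<kappa> n"
  and degree_phib: "degree (\<phi>b n) = n"
  and coeff_phib: "coeff (\<phi>b n) n = \<kappa> n"
  and pairing_phi_phib: "pairing (\<phi> m) (\<phi>b n) = (if m = n then 1 else 0)"
proof -
  show "\<kappa> n \<noteq> 0" "degree (\<phi> n) = n" "degree (\<phi>b n) = n"
    "pairing (\<phi> m) (\<phi>b n) = (if m = n then 1 else 0)"
    using biorth by (auto simp: biorthonormal_def)
  show "coeff (\<phi> n) n = \<kappa> n" "coeff (\<phi>b n) n = \<kappa> n"
    using biorth unfolding biorthonormal_def by metis+
qed

lemma phi_nz: "\<phi> n \<noteq> 0" and phib_nz: "\<phi>b n \<noteq> 0"
  using coeff_phi[of n] coeff_phib[of n] kappa_nz[of n] by auto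

lemma phi_0_eq: "\<phi> 0 = [:\<kappa> 0:]" and phib_0_eq: "\<phi>b 0 = [:\<kappa> 0:]"
  using degree_phi[of 0] coeff_phi[of 0] degree_phib[of 0] coeff_phib[of 0]
  by (metis coeff_pCons_0 degree_0_id degree_eq_zeroE)+

lemma integrand_cont:
  "continuous_on (sphere 0 1) (\<lambda>\<zeta>. w \<zeta> * poly p \<zeta> * poly q (1 / \<zeta>))"
  by (auto intro!: continuous_intros w_cont)

lemma pairing_add_left: "pairing (p + p') q = pairing p q + pairing p' q"
  using circle_int_add[OF integrand_cont[of p q] integrand_cont[of p' q]]
  by (simp add: circle_pairing_def algebra_simps)

lemma pairing_add_right: "pairing p (q + q') = pairing p q + pairing p q'"
  using circle_int_add[OF integrand_cont[of p q] integrand_cont[of p q']]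
  by (simp add: circle_pairing_def algebra_simps)

lemma pairing_smult_left: "pairing (smult c p) q = c * pairing p q"
  using circle_int_cmult[OF integrand_cont[of p q], of c]
  by (simp add: circle_pairing_def algebra_simps)

lemma pairing_smult_right: "pairing p (smult c q) = c * pairing p q"
  using circle_int_cmult[OF integrand_cont[of p q], of c]
  by (simp add: circle_pairing_def algebra_simps)

lemma pairing_diff_left: "pairing (p - p') q = pairing p q - pairing p' q"
  using pairing_add_left[of "p - p'" p' q] by simp

text \<open>
  The Toeplitz property: the pairing of two monomials depends only on the difference of the
  exponents.  It is what turns orthogonality of a shifted polynomial into orthogonality of the
  polynomial itself.
\<close>

lemma pairing_shift: "pairing (pCons 0 p) (pCons 0 q) = pairing p q"
  unfolding circle_pairing_def by (rule circle_int_cong) auto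

lemma pairing_phib:
  assumes "degree p \<le> n"
  shows "pairing p (\<phi>b n) = coeff p n / \<kappa> n"
  using linear_functional_top_coeff[where f = "\<lambda>p. pairing p (\<phi>b n)" and \<psi> = \<phi>,
      OF pairing_add_left pairing_smult_left degree_phi phi_nz _ assms]
  by (simp add: pairing_phi_phib degree_phi coeff_phi)

lemma pairing_phi:
  assumes "degree q \<le> n"
  shows "pairing (\<phi> n) q = coeff q n / \<kappa> n"
  using linear_functional_top_coeff[where f = "\<lambda>q. pairing (\<phi> n) q" and \<psi> = \<phi>b,
      OF pairing_add_right pairing_smult_right degree_phib phib_nz _ assms]
  by (simp add: pairing_phi_phib degree_phib coeff_phib)

text \<open>
  Since \<open>\<phi>*\<^sub>n(\<zeta>) \<zeta>^(-j)\<close> is \<open>\<zeta>^(n - j)\<close> times the value at \<open>1/\<zeta>\<close> of the \<open>n\<close>-th polynomial of the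
  second family, orthogonality to the exponents \<open>0, \<dots>, n - 1\<close> becomes orthogonality to
  \<open>1, \<dots>, n\<close>.
\<close>

lemma pairing_reciprocal:
  assumes "j \<le> n"
  shows "pairing (\<phi>s n) (monom 1 j) = (if j = 0 then 1 / \<kappa> n else 0)"
proof -
  have "pairing (\<phi>s n) (monom 1 j) = pairing (monom 1 (n - j)) (\<phi>b n)"
    unfolding circle_pairing_def
  proof (rule circle_int_cong)
    fix \<zeta> :: complex assume "cmod \<zeta> = 1"
    then have "\<zeta> \<noteq> 0" by auto
    then show "w \<zeta> * poly (\<phi>s n) \<zeta> * poly (monom 1 j) (1 / \<zeta>)
        = w \<zeta> * poly (monom 1 (n - j)) \<zeta> * poly (\<phi>b n) (1 / \<zeta>)"
      using assms
      by (simp add: poly_reflect_poly_degree[OF degree_phib] poly_monom power_diff power_divide)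
  qed
  also have "\<dots> = coeff (monom 1 (n - j)) n / \<kappa> n"
    by (rule pairing_phib) (simp add: degree_monom_eq)
  finally show ?thesis using assms by auto
qed

text \<open>
  If \<open>d\<close> had degree \<open>m\<close>, pairing it with the \<open>m\<close>-th polynomial of the second family would read
  off its leading coefficient, but that pairing is a combination of the vanishing ones.
\<close>

lemma pairing_nondegenerate:
  assumes coeffs: "\<And>k. k \<ge> n \<Longrightarrow> coeff d k = 0"
    and orth: "\<And>j. j < n \<Longrightarrow> pairing d (monom 1 j) = 0"
  shows "d = 0"
proof (rule ccontr)
  assume "d \<noteq> 0"
  define m where "m = degree d"
  have "coeff d m \<noteq> 0" using \<open>d \<noteq> 0\<close> by (simp add: m_def)
  then have "m < n" using coeffs not_less by blast
  have "pairing d (\<phi>b m) = 0"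
    using linear_functional_vanishes[where f = "pairing d" and \<psi> = "monom 1" and n = n,
        OF pairing_add_right pairing_smult_right _ _ orth, of "\<phi>b m"] \<open>m < n\<close>
    by (simp add: degree_monom_eq coeff_eq_0 degree_phib)
  then show False
    using pairing_phib[of d m] \<open>coeff d m \<noteq> 0\<close> kappa_nz[of m] by (simp add: m_def)
qed

text \<open>
  The range of exponents \<open>1, \<dots>, n\<close> is the one to which both \<open>z \<phi>\<^sub>n\<close> and \<open>\<phi>*\<^sub>n\<close> are orthogonal,
  so this criterion serves both Szego recurrences.
\<close>

lemma zero_if_orthogonal_shifted:
  assumes "coeff q 0 = 0" "\<And>k. k > n \<Longrightarrow> coeff q k = 0"
    and orth: "\<And>j. j < n \<Longrightarrow> pairing q (monom 1 (Suc j)) = 0"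
  shows "q = 0"
proof -
  obtain d where q: "q = pCons 0 d"
    using assms(1) by (metis coeff_pCons_0 pCons_cases)
  have "d = 0"
  proof (rule pairing_nondegenerate[of n])
    show "coeff d k = 0" if "k \<ge> n" for k
      using assms(2)[of "Suc k"] that by (simp add: q)
    show "pairing d (monom 1 j) = 0" if "j < n" for j
      using orth[OF that] by (simp add: q monom_Suc pairing_shift)
  qed
  then show ?thesis by (simp add: q)
qed

lemma coeff_reciprocal: "coeff (\<phi>s n) k = (if k \<le> n then coeff (\<phi>b n) (n - k) else 0)"
  by (simp add: coeff_reflect_poly degree_phib)

text \<open>
  The coefficients on the right are forced by the terms of degree \<open>n + 1\<close> and \<open>0\<close>; the rest of
  the difference of the two sides vanishes by orthogonality.
\<close>

lemma szego_phi:
  "smult (\<kappa> n) (\<phi> (n + 1)) =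
     smult (\<kappa> (n + 1)) (pCons 0 (\<phi> n)) + smult (poly (\<phi> (n + 1)) 0) (\<phi>s n)"
    (is "?l = ?r1 + ?r2")
proof -
  have "?l - ?r1 - ?r2 = 0"
  proof (rule zero_if_orthogonal_shifted[of _ n])
    show "coeff (?l - ?r1 - ?r2) 0 = 0"
      by (simp add: poly_0_coeff_0 degree_phib coeff_phib)
    show "coeff (?l - ?r1 - ?r2) k = 0" if "k > n" for k
    proof (cases "k = n + 1")
      case True
      then show ?thesis using coeff_phi[of "n + 1"] coeff_phi[of n] by (simp add: coeff_reciprocal)
    next
      case False
      then show ?thesis using that
        by (simp add: coeff_reciprocal coeff_eq_0 degree_phi coeff_pCons split: nat.split)
    qed
    show "pairing (?l - ?r1 - ?r2) (monom 1 (Suc j)) = 0" if "j < n" for j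
    proof -
      have "pairing (\<phi> (n + 1)) (monom 1 (Suc j)) = 0"
        using that by (subst pairing_phi) (auto simp: degree_monom_eq)
      moreover have "pairing (pCons 0 (\<phi> n)) (monom 1 (Suc j)) = 0"
        unfolding monom_Suc pairing_shift
        using that by (subst pairing_phi) (auto simp: degree_monom_eq)
      ultimately show ?thesis using that
        by (simp add: pairing_diff_left pairing_smult_left pairing_reciprocal del: smult_pCons)
    qed
  qed
  then show ?thesis by (simp only: diff_diff_eq right_minus_eq)
qed

lemma szego_reciprocal:
  "smult (\<kappa> n) (\<phi>s (n + 1)) =
     smult (poly (\<phi>b (n + 1)) 0) (pCons 0 (\<phi> n)) + smult (\<kappa> (n + 1)) (\<phi>s n)"
    (is "?l = ?r1 + ?r2")
proof -
  have "?l - ?r1 - ?r2 = 0"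
  proof (rule zero_if_orthogonal_shifted[of _ n])
    show "coeff (?l - ?r1 - ?r2) 0 = 0"
      using coeff_phib[of "n + 1"] coeff_phib[of n] by (simp add: degree_phib)
    show "coeff (?l - ?r1 - ?r2) k = 0" if "k > n" for k
    proof (cases "k = n + 1")
      case True
      then show ?thesis using coeff_phi[of n]
        by (simp add: coeff_reciprocal poly_0_coeff_0)
    next
      case False
      then show ?thesis using that
        by (simp add: coeff_reciprocal coeff_eq_0 degree_phi coeff_pCons split: nat.split)
    qed
    show "pairing (?l - ?r1 - ?r2) (monom 1 (Suc j)) = 0" if "j < n" for j
    proof -
      have "pairing (pCons 0 (\<phi> n)) (monom 1 (Suc j)) = 0"
        unfolding monom_Suc pairing_shift
        using that by (subst pairing_phi) (auto simp: degree_monom_eq)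
      then show ?thesis using that
        by (simp add: pairing_diff_left pairing_smult_left pairing_reciprocal del: smult_pCons)
    qed
  qed
  then show ?thesis by (simp only: diff_diff_eq right_minus_eq)
qed

lemma pairing_reciprocal_1: "pairing (\<phi>s n) 1 = 1 / \<kappa> n"
  using pairing_reciprocal[of 0 n] by (simp add: monom_eq_1)

lemma pairing_phi_1: "pairing (\<phi> n) 1 = (if n = 0 then 1 / \<kappa> 0 else 0)"
  by (subst pairing_phi) auto

text \<open>
  The first moment of \<open>\<phi>\<^sub>n\<close> that orthogonality leaves undetermined; it follows by pairing
  the recurrence for \<open>\<phi>\<^sub>n\<^sub>+\<^sub>1\<close> with \<open>1\<close>.
\<close>

lemma pairing_shifted_phi:
  "pairing (pCons 0 (\<phi> n)) 1 = - poly (\<phi> (n + 1)) 0 / (\<kappa> n * \<kappa> (n + 1))"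
proof -
  have "0 = \<kappa> n * pairing (\<phi> (n + 1)) 1"
    by (simp add: pairing_phi_1)
  also have "\<dots> = \<kappa> (n + 1) * pairing (pCons 0 (\<phi> n)) 1 + poly (\<phi> (n + 1)) 0 / \<kappa> n"
    using arg_cong[OF szego_phi[of n], of "\<lambda>p. pairing p 1"]
    by (simp only: pairing_smult_left pairing_add_left pairing_reciprocal_1) simp
  finally show ?thesis
    using kappa_nz[of n] kappa_nz[of "n + 1"] by (simp add: field_simps eq_neg_iff_add_eq_0)
qed

text \<open>
  Here the recurrence for the reciprocal polynomials is paired with \<open>1\<close>.
\<close>

lemma kappa_square_diff:
  "(\<kappa> (n + 1))\<^sup>2 - (\<kappa> n)\<^sup>2 = poly (\<phi> (n + 1)) 0 * poly (\<phi>b (n + 1)) 0"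
proof -
  have "\<kappa> n / \<kappa> (n + 1) = \<kappa> (n + 1) / \<kappa> n
      - poly (\<phi>b (n + 1)) 0 * poly (\<phi> (n + 1)) 0 / (\<kappa> n * \<kappa> (n + 1))"
    using arg_cong[OF szego_reciprocal[of n], of "\<lambda>p. pairing p 1"]
    by (simp only: pairing_smult_left pairing_add_left pairing_reciprocal_1 pairing_shifted_phi) simp
  then show ?thesis
    using kappa_nz[of n] kappa_nz[of "n + 1"] by (simp add: field_simps power2_eq_square)
qed

section \<open>The associated functions\<close>

definition herglotz :: "complex poly \<Rightarrow> complex \<Rightarrow> complex" where
  "herglotz p z = circle_int (\<lambda>\<zeta>. (\<zeta> + z) / (\<zeta> - z) * w \<zeta> * poly p \<zeta>)"

lemma herglotz_integrand_cont:
  assumes "cmod z \<noteq> 1"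
  shows "continuous_on (sphere 0 1) (\<lambda>\<zeta>. (\<zeta> + z) / (\<zeta> - z) * w \<zeta> * poly p \<zeta>)"
  using assms by (auto intro!: continuous_intros w_cont)

lemma herglotz_add:
  assumes "cmod z \<noteq> 1"
  shows "herglotz (p + q) z = herglotz p z + herglotz q z"
  using circle_int_add[OF herglotz_integrand_cont[OF assms, of p] herglotz_integrand_cont[OF assms, of q]]
  by (simp add: herglotz_def ring_distribs)

lemma herglotz_smult:
  assumes "cmod z \<noteq> 1"
  shows "herglotz (smult c p) z = c * herglotz p z"
  using circle_int_cmult[OF herglotz_integrand_cont[OF assms, of p], of c]
  by (simp add: herglotz_def mult_ac)

text \<open>
  This rests on \<open>\<zeta> (\<zeta> + z)/(\<zeta> - z) = z (\<zeta> + z)/(\<zeta> - z) + \<zeta> + z\<close>.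
\<close>

lemma herglotz_shift:
  assumes z: "cmod z \<noteq> 1"
  shows "herglotz (pCons 0 p) z = z * herglotz p z + pairing (pCons 0 p) 1 + z * pairing p 1"
proof -
  have "herglotz (pCons 0 p) z = circle_int (\<lambda>\<zeta>. z * ((\<zeta> + z) / (\<zeta> - z) * w \<zeta> * poly p \<zeta>)
      + (w \<zeta> * poly (pCons 0 p) \<zeta> * poly 1 (1 / \<zeta>) + z * (w \<zeta> * poly p \<zeta> * poly 1 (1 / \<zeta>))))"
    unfolding herglotz_def
  proof (rule circle_int_cong)
    fix \<zeta> :: complex assume "cmod \<zeta> = 1"
    then have "\<zeta> - z \<noteq> 0" using z by auto
    then show "(\<zeta> + z) / (\<zeta> - z) * w \<zeta> * poly (pCons 0 p) \<zeta>
      = z * ((\<zeta> + z) / (\<zeta> - z) * w \<zeta> * poly p \<zeta>)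
      + (w \<zeta> * poly (pCons 0 p) \<zeta> * poly 1 (1 / \<zeta>) + z * (w \<zeta> * poly p \<zeta> * poly 1 (1 / \<zeta>)))"
      by (simp add: divide_simps) (simp add: algebra_simps)
  qed
  also have "\<dots> = z * herglotz p z + (pairing (pCons 0 p) 1 + z * pairing p 1)"
    unfolding circle_pairing_def herglotz_def
    by (subst circle_int_add circle_int_cmult,
        (intro continuous_on_mult[OF continuous_on_const] continuous_on_add
          herglotz_integrand_cont[OF z] integrand_cont)+)+ simp
  finally show ?thesis by simp
qed

text \<open>
  Because \<open>(\<zeta> + z)/((\<zeta> - z) \<zeta>) = 2/(\<zeta> - z) - 1/\<zeta>\<close>, the transform is a Cauchy integral over the
  circle plus a constant.
\<close>

lemma herglotz_differentiable:
  assumes z: "cmod z \<noteq> 1"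
  shows "herglotz p field_differentiable at z"
proof -
  define g where "g = (\<lambda>\<zeta>. w \<zeta> * poly p \<zeta>)"
  have g: "continuous_on (sphere 0 1) g"
    unfolding g_def by (intro continuous_intros w_cont)
  have cauchy_cont: "continuous_on (sphere 0 1) (\<lambda>u. g u / (\<i> * of_real pi) / (u - x) ^ 1)"
    if "cmod x \<noteq> 1" for x using that by (auto intro!: continuous_intros g)
  define G where "G x = contour_integral (circlepath 0 1) (\<lambda>u. g u / (\<i> * of_real pi) / (u - x) ^ 1)" for x
  have "(G has_field_derivative
      of_nat 1 * contour_integral (circlepath 0 1) (\<lambda>u. g u / (\<i> * of_real pi) / (u - z) ^ Suc 1)) (at z)"
  \<comment> \<open>\<open>2\<pi>\<close> is the speed of \<^term>\<open>circlepath 0 1\<close>.\<close>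
  proof (rule Cauchy_next_derivative(2)[where S = UNIV and B = "2 * pi"])
    show "continuous_on (path_image (circlepath 0 1)) (\<lambda>u. g u / (\<i> * of_real pi))"
      by (auto intro!: continuous_intros g)
    show "((\<lambda>u. g u / (\<i> * of_real pi) / (u - x) ^ 1) has_contour_integral G x) (circlepath 0 1)"
      if "x \<in> UNIV - path_image (circlepath 0 1)" for x
      unfolding G_def
      by (rule has_contour_integral_integral, rule contour_integrable_continuous_circlepath)
         (use that cauchy_cont[of x] in auto)
  qed (use z in \<open>auto simp: vector_derivative_circlepath norm_mult\<close>)
  then have diff: "(\<lambda>x. G x + - circle_int g) field_differentiable at z"
    by (intro field_differentiable_add field_differentiable_const)
       (auto simp: field_differentiable_def)
  have eq: "G x + - circle_int g = herglotz p x" if "x \<in> - sphere 0 1" for x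
  proof -
    have x: "cmod x \<noteq> 1" using that by auto
    have "herglotz p x = contour_integral (circlepath 0 1)
      (\<lambda>u. g u / (\<i> * of_real pi) / (u - x) ^ 1 + (-1) * (g u / (2 * of_real pi * \<i> * u)))"
      unfolding herglotz_def circle_int_def
    proof (rule contour_integral_eq)
      fix u assume "u \<in> path_image (circlepath 0 1)"
      then have "u \<noteq> 0" "u - x \<noteq> 0" using x by auto
      then show "(u + x) / (u - x) * w u * poly p u / (2 * of_real pi * \<i> * u) =
         g u / (\<i> * of_real pi) / (u - x) ^ 1 + (-1) * (g u / (2 * of_real pi * \<i> * u))"
        by (simp add: g_def divide_simps) (simp add: algebra_simps)
    qed
    also have "\<dots> = G x + (-1) * circle_int g"
      unfolding G_def circle_int_def
      using circle_int_integrable[OF g]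
        contour_integrable_continuous_circlepath[of 0 1 "\<lambda>u. g u / (\<i> * of_real pi) / (u - x) ^ 1"]
        cauchy_cont[OF x]
      by (subst contour_integral_add)
         (auto intro!: contour_integrable_lmul contour_integrable_neg simp: contour_integral_lmul contour_integral_neg)
    finally show ?thesis by simp
  qed
  show ?thesis
    by (rule field_differentiable_cong_open[where S = "- sphere 0 1", OF diff _ _ eq]) (use z in auto)
qed

abbreviation \<epsilon> :: "nat \<Rightarrow> complex \<Rightarrow> complex" where "\<epsilon> \<equiv> assoc_fun w \<kappa> \<phi>"
abbreviation \<epsilon>s :: "nat \<Rightarrow> complex \<Rightarrow> complex" where "\<epsilon>s \<equiv> assoc_fun_star w \<kappa> \<phi>b"

lemma caratheodory_eq:
  assumes "cmod z \<noteq> 1"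
  shows "\<kappa> 0 * caratheodory w z = herglotz [:\<kappa> 0:] z"
  using circle_int_cmult[OF herglotz_integrand_cont[OF assms, of 1], of "\<kappa> 0"]
  by (simp add: caratheodory_def herglotz_def mult_ac)

lemma assoc_fun_eq:
  assumes "cmod z \<noteq> 1"
  shows "\<epsilon> n z = herglotz (\<phi> n) z + (if n = 0 then 1 / \<kappa> 0 else 0)"
  using caratheodory_eq[OF assms] by (simp add: assoc_fun_def herglotz_def phi_0_eq)

text \<open>
  Replacing \<open>j\<close> by \<open>j + 1\<close> changes the integral by a combination of the pairings of \<open>\<phi>*\<^sub>n\<close> with
  the monomials of degree \<open>j\<close> and \<open>j + 1\<close>, since \<open>(\<zeta> + z)/(\<zeta> - z) (1 - z/\<zeta>) = 1 + z/\<zeta>\<close>.  Only the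
  monomial of degree \<open>0\<close> contributes, so the integrals for \<open>j = 1, \<dots>, n\<close> agree and differ from
  the one for \<open>j = 0\<close> by \<open>1/\<kappa>\<^sub>n\<close>.
\<close>

lemma herglotz_reciprocal_telescope:
  assumes z: "cmod z \<noteq> 1" and "1 \<le> j" "j \<le> n"
  shows "circle_int (\<lambda>\<zeta>. (\<zeta> + z) / (\<zeta> - z) * w \<zeta> * poly (\<phi>s n) \<zeta> * (z / \<zeta>) ^ j)
     = herglotz (\<phi>s n) z - 1 / \<kappa> n"
proof -
  define I where "I j = circle_int (\<lambda>\<zeta>. (\<zeta> + z) / (\<zeta> - z) * w \<zeta> * poly (\<phi>s n) \<zeta> * (z / \<zeta>) ^ j)" for j
  have cont: "continuous_on (sphere 0 1)
      (\<lambda>\<zeta>. (\<zeta> + z) / (\<zeta> - z) * w \<zeta> * poly (\<phi>s n) \<zeta> * (z / \<zeta>) ^ j)" for j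
    using z by (auto intro!: continuous_intros w_cont)
  have step: "I j = I (Suc j) + (z ^ j * pairing (\<phi>s n) (monom 1 j)
      + z ^ Suc j * pairing (\<phi>s n) (monom 1 (Suc j)))" for j
  proof -
    let ?m = "\<lambda>j \<zeta>. w \<zeta> * poly (\<phi>s n) \<zeta> * poly (monom 1 j) (1 / \<zeta>)"
    have "I j = circle_int (\<lambda>\<zeta>. (\<zeta> + z) / (\<zeta> - z) * w \<zeta> * poly (\<phi>s n) \<zeta> * (z / \<zeta>) ^ Suc j
        + (z ^ j * ?m j \<zeta> + z ^ Suc j * ?m (Suc j) \<zeta>))"
      unfolding I_def
    proof (rule circle_int_cong)
      fix \<zeta> :: complex assume "cmod \<zeta> = 1"
      then have nz: "\<zeta> - z \<noteq> 0" "\<zeta> \<noteq> 0" using z by auto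
      define K q A where "K = (\<zeta> + z) / (\<zeta> - z)" and "q = z / \<zeta>"
        and "A = w \<zeta> * poly (\<phi>s n) \<zeta>"
      have K: "K = K * q + (1 + q)"
        using nz unfolding K_def q_def by (simp add: divide_simps) (simp add: algebra_simps)
      have m: "z ^ i * ?m i \<zeta> = A * q ^ i" for i
        by (simp add: A_def q_def poly_monom power_divide)
      have "K * (A * q ^ j) = (K * q + (1 + q)) * (A * q ^ j)"
        by (rule arg_cong[OF K])
      also have "\<dots> = K * A * q ^ Suc j + (A * q ^ j + A * q ^ Suc j)"
        by (simp add: algebra_simps)
      finally show "(\<zeta> + z) / (\<zeta> - z) * w \<zeta> * poly (\<phi>s n) \<zeta> * (z / \<zeta>) ^ j =
         (\<zeta> + z) / (\<zeta> - z) * w \<zeta> * poly (\<phi>s n) \<zeta> * (z / \<zeta>) ^ Suc j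
         + (z ^ j * ?m j \<zeta> + z ^ Suc j * ?m (Suc j) \<zeta>)"
        unfolding m K_def q_def A_def by (simp only: mult.assoc)
    qed
    also have "\<dots> = I (Suc j) + (z ^ j * pairing (\<phi>s n) (monom 1 j)
        + z ^ Suc j * pairing (\<phi>s n) (monom 1 (Suc j)))"
      unfolding circle_pairing_def I_def
      by (subst circle_int_add circle_int_cmult,
        (intro continuous_on_mult[OF continuous_on_const] continuous_on_add cont integrand_cont)+)+ simp
    finally show ?thesis .
  qed
  have I0: "I 0 = herglotz (\<phi>s n) z" by (simp add: I_def herglotz_def)
  have "I j = herglotz (\<phi>s n) z - 1 / \<kappa> n"
    using \<open>1 \<le> j\<close> \<open>j \<le> n\<close>
  proof (induction j rule: nat_induct_at_least)
    case base
    then show ?case using step[of 0] I0 pairing_reciprocal[of 1 n] by (simp add: pairing_reciprocal_1)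
  next
    case (Suc j)
    then show ?case using step[of j] by (simp add: pairing_reciprocal)
  qed
  then show ?thesis by (simp add: I_def)
qed

text \<open>
  On the circle \<open>z^n\<close> times the second polynomial at \<open>1/\<zeta>\<close> is \<open>\<phi>*\<^sub>n(\<zeta>) (z/\<zeta>)^n\<close>, so this is the
  telescoped integral with \<open>j = n\<close>.  The special definition for \<open>n = 0\<close> fits the same formula,
  so the recurrences below hold from \<open>n = 0\<close> on.
\<close>

lemma assoc_fun_star_eq:
  assumes z: "cmod z \<noteq> 1"
  shows "\<epsilon>s n z = 1 / \<kappa> n - herglotz (\<phi>s n) z"
proof (cases "n = 0")
  case True
  then show ?thesis using caratheodory_eq[OF z] by (simp add: assoc_fun_star_def phib_0_eq)
next
  case False
  have cont: "continuous_on (sphere 0 1) (\<lambda>\<zeta>. (\<zeta> + z) / (\<zeta> - z) * w \<zeta> * poly (\<phi>b n) (1 / \<zeta>))"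
    using z by (auto intro!: continuous_intros w_cont)
  have "\<epsilon>s n z = - circle_int (\<lambda>\<zeta>. z ^ n * ((\<zeta> + z) / (\<zeta> - z) * w \<zeta> * poly (\<phi>b n) (1 / \<zeta>)))"
    using False circle_int_cmult[OF cont, of "z ^ n"] by (simp add: assoc_fun_star_def)
  also have "\<dots> = - circle_int (\<lambda>\<zeta>. (\<zeta> + z) / (\<zeta> - z) * w \<zeta> * poly (\<phi>s n) \<zeta> * (z / \<zeta>) ^ n)"
  proof (rule arg_cong[where f = uminus], rule circle_int_cong)
    fix \<zeta> :: complex assume "cmod \<zeta> = 1"
    then have "\<zeta> \<noteq> 0" by auto
    then show "z ^ n * ((\<zeta> + z) / (\<zeta> - z) * w \<zeta> * poly (\<phi>b n) (1 / \<zeta>)) =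
         (\<zeta> + z) / (\<zeta> - z) * w \<zeta> * poly (\<phi>s n) \<zeta> * (z / \<zeta>) ^ n"
      by (simp add: poly_reflect_poly_degree[OF degree_phib] power_divide)
  qed
  also have "\<dots> = 1 / \<kappa> n - herglotz (\<phi>s n) z"
    using herglotz_reciprocal_telescope[OF z, of n n] False by simp
  finally show ?thesis .
qed

lemma assoc_fun_differentiable:
  assumes z: "cmod z \<noteq> 1"
  shows "\<epsilon> n field_differentiable at z"
proof -
  have "(\<lambda>z. herglotz (\<phi> n) z + (if n = 0 then 1 / \<kappa> 0 else 0)) field_differentiable at z"
    by (intro field_differentiable_add field_differentiable_const herglotz_differentiable[OF z])
  then show ?thesis
    by (rule field_differentiable_cong_open[where S = "- sphere 0 1"])
       (use z in \<open>auto simp: assoc_fun_eq\<close>)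
qed

lemma assoc_fun_star_differentiable:
  assumes z: "cmod z \<noteq> 1"
  shows "\<epsilon>s n field_differentiable at z"
proof -
  have "(\<lambda>z. 1 / \<kappa> n - herglotz (\<phi>s n) z) field_differentiable at z"
    by (intro field_differentiable_diff field_differentiable_const herglotz_differentiable[OF z])
  then show ?thesis
    by (rule field_differentiable_cong_open[where S = "- sphere 0 1"])
       (use z in \<open>auto simp: assoc_fun_star_eq\<close>)
qed

text \<open>
  The transform of the recurrence for the polynomials produces the extra constant
  \<open>\<kappa>\<^sub>n\<^sub>+\<^sub>1\<close> times the pairing of \<open>z \<phi>\<^sub>n\<close> with \<open>1\<close>, which cancels the \<open>1/\<kappa>\<^sub>n\<close> in \<open>\<epsilon>*\<^sub>n\<close>.
\<close>

lemma szego_assoc_fun: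
  assumes z: "cmod z \<noteq> 1"
  shows "\<kappa> n * \<epsilon> (n + 1) z = \<kappa> (n + 1) * (z * \<epsilon> n z) - poly (\<phi> (n + 1)) 0 * \<epsilon>s n z"
proof -
  have "\<kappa> n * herglotz (\<phi> (n + 1)) z
      = \<kappa> (n + 1) * herglotz (pCons 0 (\<phi> n)) z + poly (\<phi> (n + 1)) 0 * herglotz (\<phi>s n) z"
    using arg_cong[OF szego_phi[of n], of "\<lambda>p. herglotz p z"]
    by (simp only: herglotz_add[OF z] herglotz_smult[OF z])
  then show ?thesis
    using kappa_nz[of n] kappa_nz[of "n + 1"] kappa_nz[of 0]
    by (auto simp: assoc_fun_eq[OF z] assoc_fun_star_eq[OF z] herglotz_shift[OF z] pairing_phi_1
        pairing_shifted_phi algebra_simps)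
qed

text \<open>
  The constants \<open>1/\<kappa>\<^sub>n\<close> and \<open>1/\<kappa>\<^sub>n\<^sub>+\<^sub>1\<close> and the pairing of \<open>z \<phi>\<^sub>n\<close> with \<open>1\<close> cancel because of
  \<open>kappa_square_diff\<close>.
\<close>

lemma szego_assoc_fun_star:
  assumes z: "cmod z \<noteq> 1"
  shows "\<kappa> n * \<epsilon>s (n + 1) z = \<kappa> (n + 1) * \<epsilon>s n z - poly (\<phi>b (n + 1)) 0 * (z * \<epsilon> n z)"
proof -
  have "\<kappa> n * herglotz (\<phi>s (n + 1)) z
      = poly (\<phi>b (n + 1)) 0 * herglotz (pCons 0 (\<phi> n)) z + \<kappa> (n + 1) * herglotz (\<phi>s n) z"
    using arg_cong[OF szego_reciprocal[of n], of "\<lambda>p. herglotz p z"]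
    by (simp only: herglotz_add[OF z] herglotz_smult[OF z])
  moreover have "\<kappa> n / \<kappa> (n + 1) = \<kappa> (n + 1) / \<kappa> n
      + poly (\<phi>b (n + 1)) 0 * pairing (pCons 0 (\<phi> n)) 1"
    using kappa_square_diff[of n] kappa_nz[of n] kappa_nz[of "n + 1"]
    unfolding pairing_shifted_phi by (simp add: field_simps power2_eq_square)
  ultimately show ?thesis
    by (simp add: assoc_fun_eq[OF z] assoc_fun_star_eq[OF z] herglotz_shift[OF z] pairing_phi_1
        algebra_simps)
qed

lemma szego_phi_value:
  "\<kappa> n * poly (\<phi> (n + 1)) z
     = \<kappa> (n + 1) * (z * poly (\<phi> n) z) + poly (\<phi> (n + 1)) 0 * poly (\<phi>s n) z"
  using arg_cong[OF szego_phi[of n], of "\<lambda>p. poly p z"] by simp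

lemma szego_reciprocal_value:
  "\<kappa> n * poly (\<phi>s (n + 1)) z
     = poly (\<phi>b (n + 1)) 0 * (z * poly (\<phi> n) z) + \<kappa> (n + 1) * poly (\<phi>s n) z"
  using arg_cong[OF szego_reciprocal[of n], of "\<lambda>p. poly p z"] by simp

text \<open>
  The recurrence matrix has determinant \<open>(\<kappa>\<^sub>n\<^sub>+\<^sub>1\<^sup>2 - a b) z / \<kappa>\<^sub>n\<^sup>2 = z\<close>, where \<open>a\<close> and \<open>b\<close> are the
  values at \<open>0\<close> of the polynomials of degree \<open>n + 1\<close>.
\<close>

lemma casoratian:
  assumes z: "cmod z \<noteq> 1"
  shows "poly (\<phi> n) z * \<epsilon>s n z + poly (\<phi>s n) z * \<epsilon> n z = 2 * z ^ n"
proof (induction n)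
  case 0
  then show ?case using kappa_nz[of 0]
    by (simp add: assoc_fun_def assoc_fun_star_def phi_0_eq phib_0_eq algebra_simps)
next
  case (Suc n)
  define P where "P = poly (\<phi> n) z"
  define S where "S = poly (\<phi>s n) z"
  have "(\<kappa> n)\<^sup>2 * (poly (\<phi> (n + 1)) z * \<epsilon>s (n + 1) z + poly (\<phi>s (n + 1)) z * \<epsilon> (n + 1) z)
     = (\<kappa> n * poly (\<phi> (n + 1)) z) * (\<kappa> n * \<epsilon>s (n + 1) z)
       + (\<kappa> n * poly (\<phi>s (n + 1)) z) * (\<kappa> n * \<epsilon> (n + 1) z)"
    by (simp add: algebra_simps power2_eq_square)
  also have "\<dots> = ((\<kappa> (n + 1))\<^sup>2 - poly (\<phi> (n + 1)) 0 * poly (\<phi>b (n + 1)) 0) * z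
       * (P * \<epsilon>s n z + S * \<epsilon> n z)"
    unfolding szego_phi_value szego_reciprocal_value szego_assoc_fun[OF z] szego_assoc_fun_star[OF z]
    by (simp add: P_def S_def algebra_simps power2_eq_square)
  also have "\<dots> = (\<kappa> n)\<^sup>2 * (2 * z ^ (n + 1))"
    using kappa_square_diff[of n] Suc by (simp add: P_def S_def algebra_simps)
  finally show ?case using kappa_nz[of n] by simp
qed

end

section \<open>Compatibility of the recurrences with the differential relations\<close>

lemma deriv_linear_recurrence:
  fixes f f1 g :: "complex \<Rightarrow> complex"
  assumes "open S" "z \<in> S"
    and rec: "\<And>x. x \<in> S \<Longrightarrow> k * f1 x = c * (x * f x) + d * g x"
    and "f1 field_differentiable at z" "f field_differentiable at z" "g field_differentiable at z"
  shows "k * deriv f1 z = c * (f z + z * deriv f z) + d * deriv g z"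
proof -
  have f1: "(f1 has_field_derivative deriv f1 z) (at z)"
    and f: "(f has_field_derivative deriv f z) (at z)"
    and g: "(g has_field_derivative deriv g z) (at z)"
    using assms(4-6) by (auto simp: field_differentiable_derivI)
  have "((\<lambda>x. k * f1 x) has_field_derivative k * deriv f1 z) (at z)"
    by (intro DERIV_cmult f1)
  moreover have "((\<lambda>x. c * (x * f x) + d * g x) has_field_derivative
      c * (f z + z * deriv f z) + d * deriv g z) (at z)"
    by (rule derivative_eq_intros f g refl)+ (simp add: algebra_simps)
  then have "((\<lambda>x. k * f1 x) has_field_derivative c * (f z + z * deriv f z) + d * deriv g z) (at z)"
    by (rule has_field_derivative_transform_within_open[OF _ assms(1,2)]) (simp add: rec)
  ultimately show ?thesis by (rule DERIV_unique)
qed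

text \<open>
  One component of the vector equation obtained by applying \<open>W d/dz + diag(V, -V)\<close> to the
  recurrence for \<open>p\<^sub>n\<^sub>+\<^sub>1\<close> and rewriting everything in terms of \<open>p\<^sub>n\<close> and \<open>p\<^sub>n\<^sub>+\<^sub>1\<close>.  The number \<open>v\<close>
  stands for \<open>V\<close> or \<open>-V\<close>; it cancels, so the two factors are the same for both components.
\<close>

lemma compatibility_phi:
  fixes z :: complex
  assumes nz: "k \<noteq> 0" "k' \<noteq> 0" "a \<noteq> 0"
    and kk: "k'\<^sup>2 - k\<^sup>2 = a * b"
    and p1: "k * p1 = k' * (z * p) + a * s"
    and s1: "k * s1 = b * (z * p) + k' * s"
    and p2: "k' * p2 = k'' * (z * p1) + a2 * s1"
    and dp1: "k * dp1 = k' * (p + z * dp) + a * ds"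
    and p_rel: "W * dp = \<Theta> * p1 - (\<Omega> + v) * p"
    and s_rel: "W * ds = - \<Theta>s * s1 + (\<Omega>s - v) * s"
    and p1_rel: "W * dp1 = \<Theta>1 * p2 - (\<Omega>1 + v) * p1"
  shows "(k' * W - k' * z * (\<Omega> + \<Omega>s) + k * z * \<Theta>s + k\<^sup>2 * \<Theta>1 * a2 * z / (k' * a)) * p
    = (k * \<Theta>1 * (k'' * z / k' + a2 / a) - k * \<Omega>1 - k' * z * \<Theta> + k' * \<Theta>s - k * \<Omega>s) * p1"
proof -
  have as: "a * s = k * p1 - k' * (z * p)" using p1 by simp
  have "k * (a * s1) = a * b * (z * p) + k' * (a * s)"
    using arg_cong[OF s1, of "\<lambda>x. a * x"] by (simp add: algebra_simps)
  also have "\<dots> = k * (k' * p1 - k * (z * p))"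
    unfolding as kk[symmetric] by (simp add: algebra_simps power2_eq_square)
  finally have as1: "a * s1 = k' * p1 - k * (z * p)" using nz by simp
  then have s1': "s1 = (k' * p1 - k * (z * p)) / a" using nz by (simp add: field_simps)
  have p2': "p2 = (k'' * (z * p1) + a2 * s1) / k'" using p2 nz by (simp add: field_simps)
  have "k * (W * dp1) = k' * W * p + k' * z * (W * dp) + a * (W * ds)"
    using arg_cong[OF dp1, of "\<lambda>x. W * x"] by (simp add: algebra_simps)
  also have "\<dots> = k' * W * p + k' * z * (\<Theta> * p1 - (\<Omega> + v) * p)
      - \<Theta>s * (a * s1) + (\<Omega>s - v) * (a * s)"
    unfolding p_rel s_rel by (simp add: algebra_simps)
  also have "\<dots> = (k' * W - k' * z * (\<Omega> + \<Omega>s) + k * z * \<Theta>s) * p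
      + (k' * z * \<Theta> - k' * \<Theta>s + k * \<Omega>s) * p1 - k * v * p1"
    unfolding as as1 by (simp add: algebra_simps)
  finally have eq: "k * \<Theta>1 * p2 - k * \<Omega>1 * p1 = (k' * W - k' * z * (\<Omega> + \<Omega>s) + k * z * \<Theta>s) * p
      + (k' * z * \<Theta> - k' * \<Theta>s + k * \<Omega>s) * p1"
    unfolding p1_rel by (simp add: algebra_simps)
  have top: "k * \<Theta>1 * p2 = k * \<Theta>1 * (k'' * z / k' + a2 / a) * p1 - k\<^sup>2 * \<Theta>1 * a2 * z / (k' * a) * p"
    unfolding p2' s1' using nz by (simp add: divide_simps) (simp add: algebra_simps power2_eq_square)
  show ?thesis using eq[unfolded top] by (simp add: algebra_simps)
qed

text \<open>
  The counterpart for the recurrence for \<open>s\<^sub>n\<^sub>+\<^sub>1\<close>, in terms of \<open>s\<^sub>n\<close> and \<open>s\<^sub>n\<^sub>+\<^sub>1\<close>.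
\<close>

lemma compatibility_reciprocal:
  fixes z :: complex
  assumes nz: "k \<noteq> 0" "k' \<noteq> 0" "b \<noteq> 0" "z \<noteq> 0"
    and kk: "k'\<^sup>2 - k\<^sup>2 = a * b"
    and p1: "k * p1 = k' * (z * p) + a * s"
    and s1: "k * s1 = b * (z * p) + k' * s"
    and s2: "k' * s2 = b2 * (z * p1) + k'' * s1"
    and ds1: "k * ds1 = b * (p + z * dp) + k' * ds"
    and p_rel: "W * dp = \<Theta> * p1 - (\<Omega> + v) * p"
    and s_rel: "W * ds = - \<Theta>s * s1 + (\<Omega>s - v) * s"
    and s1_rel: "W * ds1 = - \<Theta>s1 * s2 + (\<Omega>s1 - v) * s1"
  shows "(k' * (\<Omega> + \<Omega>s) - k' * W / z - k * z * \<Theta> - k\<^sup>2 * \<Theta>s1 * b2 * z / (k' * b)) * s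
    = (k * \<Omega>s1 - k * \<Theta>s1 * (b2 * z / b + k'' / k') - k * W / z - k' * z * \<Theta> + k * \<Omega> + k' * \<Theta>s) * s1"
proof -
  have bp: "b * p = (k * s1 - k' * s) / z" using s1 nz by (simp add: field_simps)
  have bzp: "b * (z * p) = k * s1 - k' * s" using s1 by simp
  have "k * (b * p1) = k' * (b * (z * p)) + a * b * s"
    using arg_cong[OF p1, of "\<lambda>x. b * x"] by (simp add: algebra_simps)
  also have "\<dots> = k * (k' * s1 - k * s)"
    unfolding bzp kk[symmetric] by (simp add: algebra_simps power2_eq_square)
  finally have bp1: "b * p1 = k' * s1 - k * s" using nz by simp
  then have p1': "p1 = (k' * s1 - k * s) / b" using nz by (simp add: field_simps)
  have s2': "s2 = (b2 * (z * p1) + k'' * s1) / k'" using s2 nz by (simp add: field_simps)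
  have "k * (W * ds1) = W * (b * p) + b * z * (W * dp) + k' * (W * ds)"
    using arg_cong[OF ds1, of "\<lambda>x. W * x"] by (simp add: algebra_simps)
  also have "\<dots> = W * (b * p) + z * \<Theta> * (b * p1) - (\<Omega> + v) * (b * (z * p))
      + k' * (- \<Theta>s * s1 + (\<Omega>s - v) * s)"
    unfolding p_rel s_rel by (simp add: algebra_simps)
  also have "\<dots> = (k' * (\<Omega> + \<Omega>s) - k' * W / z - k * z * \<Theta>) * s
      + (k * W / z + k' * z * \<Theta> - k * \<Omega> - k' * \<Theta>s) * s1 - k * v * s1"
    unfolding bzp bp1 bp by (simp add: algebra_simps diff_divide_distrib)
  finally have eq: "- (k * \<Theta>s1 * s2) + k * \<Omega>s1 * s1 = (k' * (\<Omega> + \<Omega>s) - k' * W / z - k * z * \<Theta>) * s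
      + (k * W / z + k' * z * \<Theta> - k * \<Omega> - k' * \<Theta>s) * s1"
    unfolding s1_rel by (simp add: algebra_simps)
  have top: "k * \<Theta>s1 * s2
      = k * \<Theta>s1 * (b2 * z / b + k'' / k') * s1 - k\<^sup>2 * \<Theta>s1 * b2 * z / (k' * b) * s"
    unfolding s2' p1' using nz by (simp add: divide_simps) (simp add: algebra_simps power2_eq_square)
  show ?thesis using eq[unfolded top] by (simp add: algebra_simps)
qed

lemma proportional_vectors_coeff_zero:
  fixes x y :: complex
  assumes "x * p = y * q" "x * p' = y * q'" "p * q' - p' * q \<noteq> 0"
  shows "x = 0"
proof -
  have "x * (p * q' - p' * q) = (x * p) * q' - (x * p') * q" by (simp add: algebra_simps)
  also have "\<dots> = 0" unfolding assms(1,2) by (simp add: algebra_simps)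
  finally show ?thesis using assms(3) by simp
qed

section \<open>The identities for the coefficient functions\<close>

context biorthonormal_system
begin

text \<open>
  From here on \<open>z\<close> is a fixed point.  The relations are algebraic conditions at that point; the
  recurrences hold on the whole complement of the circle and can therefore be differentiated.
\<close>

context
  fixes W V :: "complex \<Rightarrow> complex" and \<Theta> \<Omega> \<Theta>s \<Omega>s :: "nat \<Rightarrow> complex \<Rightarrow> complex" and z :: complex
  assumes z: "cmod z \<noteq> 1" "z \<noteq> 0"
    and phi_0: "\<And>n. poly (\<phi> n) 0 \<noteq> 0"
    and phib_0: "\<And>n. poly (\<phi>b n) 0 \<noteq> 0"
    and rel: "\<And>n. coefficient_relations w \<kappa> \<phi> \<phi>b W V \<Theta> \<Omega> \<Theta>s \<Omega>s n z"
begin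

text \<open>
  The relations for the components of \<open>p\<^sub>n = (\<phi>\<^sub>n, \<epsilon>\<^sub>n)\<close> and \<open>s\<^sub>n = (\<phi>*\<^sub>n, -\<epsilon>*\<^sub>n)\<close>; the signs are
  arranged so that the second components have the form of the first ones with \<open>-V\<close> for \<open>V\<close>.
\<close>

lemma relation_phi: "W z * deriv (poly (\<phi> n)) z
      = \<Theta> n z * poly (\<phi> (n + 1)) z - (\<Omega> n z + V z) * poly (\<phi> n) z"
  and relation_eps: "W z * deriv (\<epsilon> n) z
      = \<Theta> n z * \<epsilon> (n + 1) z - (\<Omega> n z + - V z) * \<epsilon> n z"
  and relation_phis: "W z * deriv (poly (\<phi>s n)) z
      = - \<Theta>s n z * poly (\<phi>s (n + 1)) z + (\<Omega>s n z - V z) * poly (\<phi>s n) z"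
  and relation_epss: "W z * - deriv (\<epsilon>s n) z
      = - \<Theta>s n z * - \<epsilon>s (n + 1) z + (\<Omega>s n z - - V z) * - \<epsilon>s n z"
  using rel[of n] by (simp_all add: coefficient_relations_def Let_def algebra_simps)

lemmas differentiable = poly_differentiable assoc_fun_differentiable[OF z(1)]
  assoc_fun_star_differentiable[OF z(1)]

lemma off_circle: "open (- sphere (0::complex) 1)" "z \<in> - sphere 0 1"
  using z by auto

lemma deriv_szego_phi:
  "\<kappa> n * deriv (poly (\<phi> (n + 1))) z = \<kappa> (n + 1) * (poly (\<phi> n) z + z * deriv (poly (\<phi> n)) z)
     + poly (\<phi> (n + 1)) 0 * deriv (poly (\<phi>s n)) z"
  by (rule deriv_linear_recurrence[OF off_circle szego_phi_value differentiable(1,1,1)])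

lemma deriv_szego_reciprocal:
  "\<kappa> n * deriv (poly (\<phi>s (n + 1))) z
     = poly (\<phi>b (n + 1)) 0 * (poly (\<phi> n) z + z * deriv (poly (\<phi> n)) z)
     + \<kappa> (n + 1) * deriv (poly (\<phi>s n)) z"
  by (rule deriv_linear_recurrence[OF off_circle szego_reciprocal_value differentiable(1,1,1)])

lemma deriv_szego_eps:
  "\<kappa> n * deriv (\<epsilon> (n + 1)) z = \<kappa> (n + 1) * (\<epsilon> n z + z * deriv (\<epsilon> n) z)
     + poly (\<phi> (n + 1)) 0 * - deriv (\<epsilon>s n) z"
  using deriv_linear_recurrence[OF off_circle _ differentiable(2,2,3),
      of "\<kappa> n" "n + 1" "\<kappa> (n + 1)" n "- poly (\<phi> (n + 1)) 0" n] szego_assoc_fun[of _ n]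
  by simp

lemma deriv_szego_epss:
  "\<kappa> n * - deriv (\<epsilon>s (n + 1)) z = poly (\<phi>b (n + 1)) 0 * (\<epsilon> n z + z * deriv (\<epsilon> n) z)
     + \<kappa> (n + 1) * - deriv (\<epsilon>s n) z"
  using deriv_linear_recurrence[OF off_circle _ differentiable(3,2,3),
      of "\<kappa> n" "n + 1" "- poly (\<phi>b (n + 1)) 0" n "\<kappa> (n + 1)" n] szego_assoc_fun_star[of _ n]
  by (simp add: algebra_simps)

lemma szego_eps: "\<kappa> n * \<epsilon> (n + 1) z
    = \<kappa> (n + 1) * (z * \<epsilon> n z) + poly (\<phi> (n + 1)) 0 * - \<epsilon>s n z"
  and szego_epss: "\<kappa> n * - \<epsilon>s (n + 1) z
    = poly (\<phi>b (n + 1)) 0 * (z * \<epsilon> n z) + \<kappa> (n + 1) * - \<epsilon>s n z"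
  using szego_assoc_fun[OF z(1), of n] szego_assoc_fun_star[OF z(1), of n] by simp_all

text \<open>
  By the recurrence, \<open>det(p\<^sub>n, p\<^sub>n\<^sub>+\<^sub>1)\<close> is \<open>\<phi>\<^sub>n\<^sub>+\<^sub>1(0)/\<kappa>\<^sub>n\<close> times \<open>det(p\<^sub>n, s\<^sub>n)\<close>.
\<close>

lemma consecutive_phi_independent:
  "poly (\<phi> n) z * \<epsilon> (n + 1) z - \<epsilon> n z * poly (\<phi> (n + 1)) z \<noteq> 0"
proof -
  have "\<kappa> n * (poly (\<phi> n) z * \<epsilon> (n + 1) z - \<epsilon> n z * poly (\<phi> (n + 1)) z)
      = poly (\<phi> n) z * (\<kappa> n * \<epsilon> (n + 1) z) - \<epsilon> n z * (\<kappa> n * poly (\<phi> (n + 1)) z)"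
    by (simp add: algebra_simps)
  also have "\<dots> = - poly (\<phi> (n + 1)) 0 * (poly (\<phi> n) z * \<epsilon>s n z + poly (\<phi>s n) z * \<epsilon> n z)"
    unfolding szego_eps szego_phi_value by (simp add: algebra_simps)
  finally show ?thesis
    using phi_0[of "n + 1"] z(2) by (auto simp: casoratian[OF z(1)])
qed

lemma consecutive_reciprocal_independent:
  "poly (\<phi>s n) z * - \<epsilon>s (n + 1) z - - \<epsilon>s n z * poly (\<phi>s (n + 1)) z \<noteq> 0"
proof -
  have "\<kappa> n * (poly (\<phi>s n) z * - \<epsilon>s (n + 1) z - - \<epsilon>s n z * poly (\<phi>s (n + 1)) z)
      = poly (\<phi>s n) z * (\<kappa> n * - \<epsilon>s (n + 1) z) - - \<epsilon>s n z * (\<kappa> n * poly (\<phi>s (n + 1)) z)"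
    by (simp add: algebra_simps)
  also have "\<dots> = poly (\<phi>b (n + 1)) 0 * z * (poly (\<phi> n) z * \<epsilon>s n z + poly (\<phi>s n) z * \<epsilon> n z)"
    unfolding szego_epss szego_reciprocal_value by (simp add: algebra_simps)
  finally show ?thesis
    using phib_0[of "n + 1"] z(2) by (auto simp: casoratian[OF z(1)])
qed

text \<open>
  The compatibility equation says that a multiple of \<open>p\<^sub>n\<close> is a multiple of \<open>p\<^sub>n\<^sub>+\<^sub>1\<close>; by
  independence the factor of \<open>p\<^sub>n\<close> is zero, and this is the identity.
\<close>

lemma omega_sum_phi:
  "\<Omega>s n z + \<Omega> n z = (\<kappa> n)\<^sup>2 / (\<kappa> (n + 1))\<^sup>2 *
      (poly (\<phi> (n + 2)) 0 / poly (\<phi> (n + 1)) 0 * \<Theta> (n + 1) z + \<kappa> (n + 1) / \<kappa> n * \<Theta>s n z)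
    + W z / z"
proof -
  have n2: "n + 1 + 1 = n + 2" by simp
  note nz = kappa_nz[of n] kappa_nz[of "n + 1"] phi_0[of "n + 1"]
  note poly_eq = compatibility_phi[OF nz kappa_square_diff szego_phi_value
      szego_reciprocal_value szego_phi_value deriv_szego_phi relation_phi relation_phis relation_phi]
  note eps_eq = compatibility_phi[OF nz kappa_square_diff szego_eps
      szego_epss szego_eps deriv_szego_eps relation_eps relation_epss relation_eps]
  have "\<kappa> (n + 1) * W z - \<kappa> (n + 1) * z * (\<Omega> n z + \<Omega>s n z) + \<kappa> n * z * \<Theta>s n z
      + (\<kappa> n)\<^sup>2 * \<Theta> (n + 1) z * poly (\<phi> (n + 2)) 0 * z / (\<kappa> (n + 1) * poly (\<phi> (n + 1)) 0) = 0"
    by (rule proportional_vectors_coeff_zero[OF poly_eq[unfolded n2] eps_eq[unfolded n2]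
        consecutive_phi_independent])
  then show ?thesis
    using nz z(2) by (simp add: divide_simps power2_eq_square del: add_2_eq_Suc') (simp add: algebra_simps)
qed

lemma omega_sum_reciprocal:
  "\<Omega>s n z + \<Omega> n z = (\<kappa> n)\<^sup>2 / (\<kappa> (n + 1))\<^sup>2 *
      (poly (\<phi>b (n + 2)) 0 / poly (\<phi>b (n + 1)) 0 * z * \<Theta>s (n + 1) z
       + \<kappa> (n + 1) / \<kappa> n * z * \<Theta> n z)
    + W z / z"
proof -
  have n2: "n + 1 + 1 = n + 2" by simp
  note nz = kappa_nz[of n] kappa_nz[of "n + 1"] phib_0[of "n + 1"]
  note poly_eq = compatibility_reciprocal[OF nz z(2) kappa_square_diff szego_phi_value
      szego_reciprocal_value szego_reciprocal_value deriv_szego_reciprocal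
      relation_phi relation_phis relation_phis]
  note eps_eq = compatibility_reciprocal[OF nz z(2) kappa_square_diff szego_eps
      szego_epss szego_epss deriv_szego_epss relation_eps relation_epss relation_epss]
  have "\<kappa> (n + 1) * (\<Omega> n z + \<Omega>s n z) - \<kappa> (n + 1) * W z / z - \<kappa> n * z * \<Theta> n z
      - (\<kappa> n)\<^sup>2 * \<Theta>s (n + 1) z * poly (\<phi>b (n + 2)) 0 * z / (\<kappa> (n + 1) * poly (\<phi>b (n + 1)) 0) = 0"
    by (rule proportional_vectors_coeff_zero[OF poly_eq[unfolded n2] eps_eq[unfolded n2]
        consecutive_reciprocal_independent])
  then show ?thesis
    using nz z(2) by (simp add: divide_simps power2_eq_square del: add_2_eq_Suc') (simp add: algebra_simps)
qed

text \<open>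
  The logarithmic derivative of the Casoratian \<open>2 z^n\<close> is \<open>n/z\<close>.  Multiplied by \<open>W\<close> it is also the
  trace of the action of \<open>W d/dz + diag(V, -V)\<close> in the basis \<open>p\<^sub>n\<close>, \<open>s\<^sub>n\<close>.
\<close>

lemma omega_diff:
  "\<Omega>s n z - \<Omega> n z
     = - (\<kappa> (n + 1) / \<kappa> n) * (z * \<Theta> n z - \<Theta>s n z) + of_nat n * (W z / z)"
proof -
  define P where "P = poly (\<phi> n) z"
  define S where "S = poly (\<phi>s n) z"
  define P' where "P' = deriv (poly (\<phi> n)) z"
  define S' where "S' = deriv (poly (\<phi>s n)) z"
  define P1 where "P1 = poly (\<phi> (n + 1)) z"
  define S1 where "S1 = poly (\<phi>s (n + 1)) z"
  have P: "(poly (\<phi> n) has_field_derivative P') (at z)"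
    and S: "(poly (\<phi>s n) has_field_derivative S') (at z)"
    and E: "(\<epsilon> n has_field_derivative deriv (\<epsilon> n) z) (at z)"
    and T: "(\<epsilon>s n has_field_derivative deriv (\<epsilon>s n) z) (at z)"
    unfolding P'_def S'_def using differentiable field_differentiable_derivI by blast+
  have "((\<lambda>x. poly (\<phi> n) x * \<epsilon>s n x + poly (\<phi>s n) x * \<epsilon> n x) has_field_derivative
      P' * \<epsilon>s n z + P * deriv (\<epsilon>s n) z + (S' * \<epsilon> n z + S * deriv (\<epsilon> n) z)) (at z)"
    unfolding P_def S_def by (rule derivative_eq_intros P S E T refl)+ (simp add: algebra_simps)
  moreover have "((\<lambda>x. poly (\<phi> n) x * \<epsilon>s n x + poly (\<phi>s n) x * \<epsilon> n x) has_field_derivative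
      2 * (of_nat n * z ^ (n - 1))) (at z)"
    by (rule has_field_derivative_transform_within_open[OF _ off_circle, where f = "\<lambda>x. 2 * x ^ n"])
       (auto simp: casoratian intro!: derivative_eq_intros)
  ultimately have deriv_casoratian: "P' * \<epsilon>s n z + P * deriv (\<epsilon>s n) z + (S' * \<epsilon> n z + S * deriv (\<epsilon> n) z)
      = 2 * (of_nat n * z ^ (n - 1))"
    by (rule DERIV_unique)
  have cas: "P * \<epsilon>s n z + S * \<epsilon> n z = 2 * z ^ n"
    unfolding P_def S_def by (rule casoratian[OF z(1)])
  have relT: "W z * deriv (\<epsilon>s n) z = - \<Theta>s n z * \<epsilon>s (n + 1) z + (\<Omega>s n z + V z) * \<epsilon>s n z"
    using relation_epss[of n] by (simp add: algebra_simps)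
  have P1: "P1 = (\<kappa> (n + 1) * (z * P) + poly (\<phi> (n + 1)) 0 * S) / \<kappa> n"
    using szego_phi_value[of n z] kappa_nz[of n] by (simp add: P1_def P_def S_def field_simps)
  have S1: "S1 = (poly (\<phi>b (n + 1)) 0 * (z * P) + \<kappa> (n + 1) * S) / \<kappa> n"
    using szego_reciprocal_value[of n z] kappa_nz[of n] by (simp add: S1_def P_def S_def field_simps)
  have E1: "\<epsilon> (n + 1) z = (\<kappa> (n + 1) * (z * \<epsilon> n z) - poly (\<phi> (n + 1)) 0 * \<epsilon>s n z) / \<kappa> n"
    using szego_eps[of n] kappa_nz[of n] by (simp add: field_simps)
  have T1: "\<epsilon>s (n + 1) z = (\<kappa> (n + 1) * \<epsilon>s n z - poly (\<phi>b (n + 1)) 0 * (z * \<epsilon> n z)) / \<kappa> n"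
    using szego_assoc_fun_star[OF z(1), of n] kappa_nz[of n] by (simp add: field_simps)
  have "(2 * z ^ n) * (of_nat n * (W z / z)) = W z * (2 * (of_nat n * z ^ (n - 1)))"
    using z(2) by (cases n) auto
  also have "\<dots> = (W z * P') * \<epsilon>s n z + P * (W z * deriv (\<epsilon>s n) z)
        + ((W z * S') * \<epsilon> n z + S * (W z * deriv (\<epsilon> n) z))"
    unfolding deriv_casoratian[symmetric] by (simp add: algebra_simps)
  also have "\<dots> = \<Theta> n z * (P1 * \<epsilon>s n z + S * \<epsilon> (n + 1) z)
      - \<Theta>s n z * (S1 * \<epsilon> n z + P * \<epsilon>s (n + 1) z)
      + (\<Omega>s n z - \<Omega> n z) * (P * \<epsilon>s n z + S * \<epsilon> n z)"
    unfolding P'_def S'_def relation_phi relation_phis relation_eps relT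
    by (simp add: P_def S_def P1_def S1_def algebra_simps)
  also have "P1 * \<epsilon>s n z + S * \<epsilon> (n + 1) z = \<kappa> (n + 1) / \<kappa> n * z * (P * \<epsilon>s n z + S * \<epsilon> n z)"
    unfolding P1 E1 using kappa_nz[of n] by (simp add: divide_simps) (simp add: algebra_simps)
  also have "S1 * \<epsilon> n z + P * \<epsilon>s (n + 1) z = \<kappa> (n + 1) / \<kappa> n * (P * \<epsilon>s n z + S * \<epsilon> n z)"
    unfolding S1 T1 using kappa_nz[of n] by (simp add: divide_simps) (simp add: algebra_simps)
  finally have "(2 * z ^ n) * (of_nat n * (W z / z)) = (2 * z ^ n) *
      (\<kappa> (n + 1) / \<kappa> n * (z * \<Theta> n z - \<Theta>s n z) + (\<Omega>s n z - \<Omega> n z))"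
    unfolding cas by (simp add: algebra_simps)
  then have "of_nat n * (W z / z) = \<kappa> (n + 1) / \<kappa> n * (z * \<Theta> n z - \<Theta>s n z) + (\<Omega>s n z - \<Omega> n z)"
    using z(2) by (subst (asm) mult_left_cancel) auto
  then show ?thesis by (simp only: minus_mult_left[symmetric]) simp
qed

text \<open>
  Both sides come from the two expressions for \<open>\<Omega>*\<^sub>n\<^sub>-\<^sub>1 + \<Omega>\<^sub>n\<^sub>-\<^sub>1\<close>.
\<close>

lemma theta_relation:
  assumes "n \<ge> 1"
  shows "poly (\<phi> (n + 1)) 0 / poly (\<phi> n) 0 * \<Theta> n z - \<kappa> n / \<kappa> (n - 1) * z * \<Theta> (n - 1) z
    = poly (\<phi>b (n + 1)) 0 / poly (\<phi>b n) 0 * z * \<Theta>s n z - \<kappa> n / \<kappa> (n - 1) * \<Theta>s (n - 1) z"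
proof -
  obtain m where n: "n = m + 1" using assms by (metis add.commute le_Suc_ex)
  have "(\<kappa> m)\<^sup>2 / (\<kappa> (m + 1))\<^sup>2 \<noteq> 0" using kappa_nz by simp
  then have "poly (\<phi> (m + 2)) 0 / poly (\<phi> (m + 1)) 0 * \<Theta> (m + 1) z + \<kappa> (m + 1) / \<kappa> m * \<Theta>s m z
      = poly (\<phi>b (m + 2)) 0 / poly (\<phi>b (m + 1)) 0 * z * \<Theta>s (m + 1) z
       + \<kappa> (m + 1) / \<kappa> m * z * \<Theta> m z"
    using omega_sum_phi[of m] omega_sum_reciprocal[of m]
    by (metis add_right_cancel mult_left_cancel)
  then show ?thesis by (simp add: n algebra_simps)
qed

end

end

theorem corollary2p2:
  fixes w W V :: "complex \<Rightarrow> complex"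
    and C D :: "complex set"
    and r R :: real
    and \<kappa> :: "nat \<Rightarrow> complex"
    and \<phi> \<phi>b :: "nat \<Rightarrow> complex poly"
    and \<Theta> \<Omega> \<Theta>s \<Omega>s :: "nat \<Rightarrow> complex \<Rightarrow> complex"
  assumes cut: "closed C" "interior C = {}"
    and w_analytic: "w holomorphic_on (- C)"
    and w_L1: "\<And>j::int. L1_circle (\<lambda>z. z powi j * w z)"
    and dw_L1: "\<And>j::int. L1_circle (\<lambda>z. z powi j * deriv w z)"
    and annulus: "0 \<le> r" "r < 1" "1 < R"
    and w_expansion: "\<And>z. r < cmod z \<Longrightarrow> cmod z < R \<Longrightarrow>
           ((\<lambda>k::int. fourier_coeff w k * z powi k) has_sum w z) UNIV"
    and toeplitz: "\<And>n. n \<ge> 1 \<Longrightarrow> toeplitz_det w n \<noteq> 0"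
    and biorth: "biorthonormal w \<kappa> \<phi> \<phi>b"
    and phi_0: "\<And>n. poly (\<phi> n) 0 \<noteq> 0"
    and phib_0: "\<And>n. poly (\<phi>b n) 0 \<noteq> 0"
    and D: "open D"
    and W_nonzero: "\<exists>z\<in>D. W z \<noteq> 0"
    and semiclassical: "\<And>z. z \<in> D - C \<Longrightarrow> W z * deriv w z = 2 * V z * w z"
    and relations: "\<And>n z. z \<in> D \<Longrightarrow> cmod z \<noteq> 1 \<Longrightarrow> z \<noteq> 0 \<Longrightarrow>
           coefficient_relations w \<kappa> \<phi> \<phi>b W V \<Theta> \<Omega> \<Theta>s \<Omega>s n z"
  shows "\<forall>z\<in>D. cmod z \<noteq> 1 \<longrightarrow> z \<noteq> 0 \<longrightarrow>
     (\<forall>n\<ge>1.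
        poly (\<phi> (n + 1)) 0 / poly (\<phi> n) 0 * \<Theta> n z - \<kappa> n / \<kappa> (n - 1) * z * \<Theta> (n - 1) z
        = poly (\<phi>b (n + 1)) 0 / poly (\<phi>b n) 0 * z * \<Theta>s n z - \<kappa> n / \<kappa> (n - 1) * \<Theta>s (n - 1) z) \<and>
     (\<forall>n.
        \<Omega>s n z - \<Omega> n z
        = - (\<kappa> (n + 1) / \<kappa> n) * (z * \<Theta> n z - \<Theta>s n z) + of_nat n * (W z / z)) \<and>
     (\<forall>n.
        \<Omega>s n z + \<Omega> n z
        = (\<kappa> n)\<^sup>2 / (\<kappa> (n + 1))\<^sup>2 *
            (poly (\<phi> (n + 2)) 0 / poly (\<phi> (n + 1)) 0 * \<Theta> (n + 1) z
             + \<kappa> (n + 1) / \<kappa> n * \<Theta>s n z)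
          + W z / z)"
proof -
  have "continuous_on (sphere 0 1) w"
    by (rule continuous_on_circle_Laurent[of "fourier_coeff w"]) (use annulus w_expansion in auto)
  then interpret biorthonormal_system w \<kappa> \<phi> \<phi>b
    using biorth by unfold_locales
  show ?thesis
    using theta_relation[OF _ _ phi_0 phib_0 relations]
      omega_diff[OF _ _ phi_0 phib_0 relations] omega_sum_phi[OF _ _ phi_0 phib_0 relations]
    by blast
qed

end
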